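(* Let $p,q$ be distinct propositional variables. The class of all (strongly) mixing dynamical systems is $\mathsf{DPL}_{\omega_1}$-definable within the class of all abstract dynamical systems by the formula $\mathbf{Mix}:=\mathbf{G}\wedge\mathbf{L}$, where $$\mathbf{G}:=\bigwedge_{r,s\in\mathbb{Q}\cap[0,1]}\Big((L_rp\wedge L_sq)\to\bigwedge_{0<n\in\mathbb{N}}\ \bigvee_{m\in\mathbb{N}}\ \bigwedge_{k\ge m}L_{rs\dot{-}\frac1n}(\bigcirc^kp\wedge q)\Big),$$ $$\mathbf{L}:=\bigwedge_{r,s\in\mathbb{Q}\cap[0,1]}\Big((M_rp\wedge M_sq)\to\bigwedge_{0<n\in\mathbb{N}}\ \bigvee_{m\in\mathbb{N}}\ \bigwedge_{k\ge m}M_{\min(1,\,rs+\frac1n)}(\bigcirc^kp\wedge q)\Big).$$ That is, for every abstract dynamical system $\mathfrak{P}=\langle\Omega,\mathcal{A},\mu,f\rangle$, the formula $\mathbf{Mix}$ is valid in $\mathfrak{P}$ if and only if $f$ is mixing.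
   Context: $\mathbb{P}$ is a countable set of propositional variables. $\mathcal{L}_{\mathsf{DPL}_{\omega_1}}$-formulas: $\varphi ::= p\mid\neg\varphi\mid\bigwedge_{i\in I}\varphi_i\mid L_r\varphi\mid\bigcirc\varphi$ with $p\in\mathbb{P}$, $I$ countable, $r\in\mathbb{Q}\cap[0,1]$; other connectives, including countable $\bigvee$, are abbreviations; $M_r\varphi:=L_{1-r}\neg\varphi$; $\bigcirc^k$ is the $k$-fold iterate of $\bigcirc$. Truncated subtraction: $a\dot{-}b:=\max(a-b,0)$. An abstract dynamical system $\langle\Omega,\mathcal{A},\mu,f\rangle$ consists of a probability space $\langle\Omega,\mathcal{A},\mu\rangle$ ($\Omega\neq\emptyset$) and a measurable $f:\Omega\to\Omega$ with $\mu(f^{-1}(A))=\mu(A)$ for all $A\in\mathcal{A}$. It is (strongly) mixing if $\lim_{k\to\infty}\mu(f^{-k}(A)\cap B)=\mu(A)\mu(B)$ for all $A,B\in\mathcal{A}$. A model $\mathfrak{M}$ based on it adds a valuation $v:\mathbb{P}\to\mathcal{A}$. Satisfaction: $\mathfrak{M},w\vDash p$ iff $w\in v(p)$; $\neg$ and countable $\bigwedge$ as usual; $\mathfrak{M},w\vDash L_r\varphi$ iff $\mu(\{u:\mathfrak{M},u\vDash\varphi\})\ge r$; $\mathfrak{M},w\vDash\bigcirc\varphi$ iff $\mathfrak{M},f(w)\vDash\varphi$. A formula is valid in $\mathfrak{P}$ if it holds at every world of every model based on $\mathfrak{P}$. *)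

theory Defs
  imports "HOL-Probability.Probability_Measure" "HOL-Library.Countable_Set_Type"
begin

locale abstract_dynamical_system = prob_space M for M :: "'a measure" +
  fixes f :: "'a \<Rightarrow> 'a"
  assumes f_measurable: "f \<in> measurable M M"
    and f_preserving: "\<And>A. A \<in> sets M \<Longrightarrow> measure M (f -` A \<inter> space M) = measure M A"

definition mixing :: "'a measure \<Rightarrow> ('a \<Rightarrow> 'a) \<Rightarrow> bool" where
  "mixing M f \<longleftrightarrow> (\<forall>A\<in>sets M. \<forall>B\<in>sets M.
     (\<lambda>k. measure M (((f ^^ k) -` A \<inter> space M) \<inter> B)) \<longlonglongrightarrow> measure M A * measure M B)"

typedef unit_rat = "{r :: rat. 0 \<le> r \<and> r \<le> 1}"
  by (rule exI[of _ 0]) simp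

setup_lifting type_definition_unit_rat

instance unit_rat :: countable
proof
  show "\<exists>g :: unit_rat \<Rightarrow> nat. inj g"
    by (rule exI[of _ "to_nat \<circ> Rep_unit_rat"])
       (auto intro!: inj_compose simp: inj_def Rep_unit_rat_inject)
qed

lift_definition compl_unit :: "unit_rat \<Rightarrow> unit_rat" is "\<lambda>r. 1 - r"
  by simp

text \<open>Truncated subtraction. At \<open>n = 0\<close> the quotient is \<open>0\<close> by convention; the formulas below
  only use \<open>n > 0\<close>.\<close>

lift_definition prod_minus :: "unit_rat \<Rightarrow> unit_rat \<Rightarrow> nat \<Rightarrow> unit_rat"
  is "\<lambda>r s n. max (r * s - 1 / of_nat n) 0"
proof -
  fix r s :: rat and n :: nat
  assume "0 \<le> r \<and> r \<le> 1" "0 \<le> s \<and> s \<le> 1"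
  then have "r * s \<le> 1" by (simp add: mult_le_one)
  moreover have "0 \<le> 1 / (of_nat n :: rat)" by simp
  ultimately show "0 \<le> max (r * s - 1 / of_nat n) 0 \<and> max (r * s - 1 / of_nat n) 0 \<le> 1"
    by linarith
qed

lift_definition prod_plus :: "unit_rat \<Rightarrow> unit_rat \<Rightarrow> nat \<Rightarrow> unit_rat"
  is "\<lambda>r s n. min 1 (r * s + 1 / of_nat n)"
  by simp

text \<open>A countable family of formulas enters a conjunction through its set of members, so that
  repetitions and the choice of index set are immaterial; finite and empty families are allowed.\<close>

datatype 'p fm =
    Prop 'p
  | Neg "'p fm"
  | Conj "'p fm cset"
  | L unit_rat "'p fm"
  | Next "'p fm"

text \<open>The index type is required to be countable, hence \<^const>\<open>acset\<close> is never applied to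
  an uncountable set here.\<close>

definition BigAnd :: "'i::countable set \<Rightarrow> ('i \<Rightarrow> 'p fm) \<Rightarrow> 'p fm" where
  "BigAnd I \<phi> = Conj (acset (\<phi> ` I))"

definition BigOr :: "'i::countable set \<Rightarrow> ('i \<Rightarrow> 'p fm) \<Rightarrow> 'p fm" where
  "BigOr I \<phi> = Neg (BigAnd I (\<lambda>i. Neg (\<phi> i)))"

definition And :: "'p fm \<Rightarrow> 'p fm \<Rightarrow> 'p fm" where
  "And \<phi> \<psi> = Conj (acset {\<phi>, \<psi>})"

definition Imp :: "'p fm \<Rightarrow> 'p fm \<Rightarrow> 'p fm" where
  "Imp \<phi> \<psi> = Neg (And \<phi> (Neg \<psi>))"

definition M_op :: "unit_rat \<Rightarrow> 'p fm \<Rightarrow> 'p fm" where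
  "M_op r \<phi> = L (compl_unit r) (Neg \<phi>)"

primrec sat :: "'a measure \<Rightarrow> ('a \<Rightarrow> 'a) \<Rightarrow> ('p \<Rightarrow> 'a set) \<Rightarrow> 'p fm \<Rightarrow> 'a \<Rightarrow> bool" where
  "sat M f v (Prop p) = (\<lambda>w. w \<in> v p)"
| "sat M f v (Neg \<phi>) = (\<lambda>w. \<not> sat M f v \<phi> w)"
| "sat M f v (Conj \<Phi>) = (\<lambda>w. \<forall>P\<in>rcset (cimage (sat M f v) \<Phi>). P w)"
| "sat M f v (L r \<phi>) =
     (\<lambda>w. measure M {u \<in> space M. sat M f v \<phi> u} \<ge> real_of_rat (Rep_unit_rat r))"
| "sat M f v (Next \<phi>) = (\<lambda>w. sat M f v \<phi> (f w))"

definition valuation :: "'a measure \<Rightarrow> ('p \<Rightarrow> 'a set) \<Rightarrow> bool" where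
  "valuation M v \<longleftrightarrow> (\<forall>p. v p \<in> sets M)"

definition valid_in :: "'a measure \<Rightarrow> ('a \<Rightarrow> 'a) \<Rightarrow> 'p fm \<Rightarrow> bool" where
  "valid_in M f \<phi> \<longleftrightarrow> (\<forall>v. valuation M v \<longrightarrow> (\<forall>w\<in>space M. sat M f v \<phi> w))"

lemma sat_Conj: "sat M f v (Conj \<Phi>) w \<longleftrightarrow> (\<forall>\<phi>\<in>rcset \<Phi>. sat M f v \<phi> w)"
  by (simp add: cimage.rep_eq)

lemma sat_BigAnd [simp]: "sat M f v (BigAnd I \<phi>) w \<longleftrightarrow> (\<forall>i\<in>I. sat M f v (\<phi> i) w)"
  unfolding BigAnd_def sat_Conj by (simp add: acset_inverse)

lemma sat_BigOr [simp]: "sat M f v (BigOr I \<phi>) w \<longleftrightarrow> (\<exists>i\<in>I. sat M f v (\<phi> i) w)"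
  by (simp add: BigOr_def)

lemma sat_And [simp]: "sat M f v (And \<phi> \<psi>) w \<longleftrightarrow> sat M f v \<phi> w \<and> sat M f v \<psi> w"
  unfolding And_def sat_Conj by (simp add: acset_inverse)

lemma sat_Imp [simp]: "sat M f v (Imp \<phi> \<psi>) w \<longleftrightarrow> (sat M f v \<phi> w \<longrightarrow> sat M f v \<psi> w)"
  by (simp add: Imp_def)

definition G_fm :: "'p \<Rightarrow> 'p \<Rightarrow> 'p fm" where
  "G_fm p q = BigAnd UNIV (\<lambda>(r, s).
     Imp (And (L r (Prop p)) (L s (Prop q)))
       (BigAnd {n :: nat. 0 < n} (\<lambda>n. BigOr (UNIV :: nat set) (\<lambda>m. BigAnd {k :: nat. k \<ge> m} (\<lambda>k.
          L (prod_minus r s n) (And ((Next ^^ k) (Prop p)) (Prop q)))))))"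

definition L_fm :: "'p \<Rightarrow> 'p \<Rightarrow> 'p fm" where
  "L_fm p q = BigAnd UNIV (\<lambda>(r, s).
     Imp (And (M_op r (Prop p)) (M_op s (Prop q)))
       (BigAnd {n :: nat. 0 < n} (\<lambda>n. BigOr (UNIV :: nat set) (\<lambda>m. BigAnd {k :: nat. k \<ge> m} (\<lambda>k.
          M_op (prod_plus r s n) (And ((Next ^^ k) (Prop p)) (Prop q)))))))"

definition Mix :: "'p \<Rightarrow> 'p \<Rightarrow> 'p fm" where
  "Mix p q = And (G_fm p q) (L_fm p q)"

end

theory Submission
  imports Defs
begin

text \<open>
  At every world, \<open>L r \<phi>\<close> and \<open>M_op r \<phi>\<close> compare the measure of the truth set of \<open>\<phi>\<close> with \<open>r\<close>
  from above and from below, so neither depends on the world. If \<open>p\<close> and \<open>q\<close> are interpreted by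
  \<open>A\<close> and \<open>B\<close>, the conjunction of \<open>(Next ^^ k) (Prop p)\<close> and \<open>Prop q\<close> has the truth set
  \<open>(f ^^ k) -` A \<inter> B\<close>. Write \<open>x k\<close> for its measure, and \<open>a\<close>, \<open>b\<close> for the measures of \<open>A\<close>, \<open>B\<close>.
  Then the first conjunct of \<open>Mix\<close> says that for all rationals \<open>r \<le> a\<close>, \<open>s \<le> b\<close> and all \<open>n > 0\<close>,
  eventually \<open>x k \<ge> r * s - 1 / n\<close>; since \<open>r * s\<close> comes arbitrarily close to \<open>a * b\<close> from below,
  this is the statement that the limit inferior of \<open>x\<close> is at least \<open>a * b\<close>
  (lemma \<open>lower_limit_iff_rational_bounds\<close>). Dually, the second conjunct says that the limit
  superior is at most \<open>a * b\<close> (\<open>upper_limit_iff_rational_bounds\<close>). Together they say that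
  \<open>x\<close> tends to \<open>a * b\<close>. Finally, because \<open>p\<close> and \<open>q\<close> are distinct, a valuation may assign to
  them any pair of events, so validity of \<open>Mix\<close> ranges over exactly the pairs in the definition
  of mixing.
\<close>

section \<open>Rational approximation in the unit interval\<close>

abbreviation ur :: "unit_rat \<Rightarrow> real" where
  "ur r \<equiv> real_of_rat (Rep_unit_rat r)"

lemma ur_nonneg: "0 \<le> ur r" and ur_le_1: "ur r \<le> 1"
  using Rep_unit_rat[of r] by auto

lemma ur_compl_unit: "ur (compl_unit r) = 1 - ur r"
  by (simp add: compl_unit.rep_eq of_rat_diff)

lemma ur_prod_minus: "ur (prod_minus r s n) = max (ur r * ur s - 1 / real n) 0"
  by (simp add: prod_minus.rep_eq max_def of_rat_diff of_rat_mult of_rat_divide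
      flip: of_rat_less_eq[where 'a = real])

lemma ur_prod_plus: "ur (prod_plus r s n) = min 1 (ur r * ur s + 1 / real n)"
  by (simp add: prod_plus.rep_eq min_def of_rat_add of_rat_mult of_rat_divide
      flip: of_rat_less_eq[where 'a = real])

lemma ex_ur_between:
  fixes x y :: real
  assumes "0 \<le> x" "x < y" "y \<le> 1"
  obtains r where "x < ur r" "ur r < y"
proof -
  obtain c where c: "x < real_of_rat c" "real_of_rat c < y"
    using of_rat_dense[OF \<open>x < y\<close>] by blast
  then have "0 \<le> real_of_rat c" "real_of_rat c \<le> 1"
    using assms by linarith+
  then have "ur (Abs_unit_rat c) = real_of_rat c"
    by (simp add: Abs_unit_rat_inverse)
  then show ?thesis
    using c that by metis
qed

text \<open>
  The endpoint \<open>a = 0\<close> needs its own witness, since no rational of the unit interval lies strictly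
  below it.
\<close>

lemma ex_ur_approx_below:
  fixes a e :: real
  assumes "0 \<le> a" "a \<le> 1" "0 < e"
  obtains r where "ur r \<le> a" "a - e < ur r"
proof (cases "a = 0")
  case True
  have "ur (Abs_unit_rat 0) = 0"
    by (simp add: Abs_unit_rat_inverse)
  then show ?thesis
    using True assms that by (metis diff_gt_0_iff_gt diff_0 neg_less_0_iff_less order_refl)
next
  case False
  then obtain r where "max 0 (a - e) < ur r" "ur r < a"
    using assms ex_ur_between[of "max 0 (a - e)" a] by auto
  then show ?thesis
    using that[of r] by simp
qed

lemma ex_ur_approx_above:
  fixes a e :: real
  assumes "0 \<le> a" "a \<le> 1" "0 < e"
  obtains r where "a \<le> ur r" "ur r < a + e"
proof -
  obtain r where "ur r \<le> 1 - a" "1 - a - e < ur r"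
    using ex_ur_approx_below[of "1 - a" e] assms by auto
  then show ?thesis
    using that[of "compl_unit r"] by (simp add: ur_compl_unit)
qed

section \<open>One-sided limits through rational bounds\<close>

text \<open>
  The reason is the decomposition \<open>a * b - r * s = a * (b - s) + s * (a - r)\<close>: each summand is a
  defect of at most \<open>e\<close> weighted by a number of the unit interval.
\<close>

lemma unit_interval_mult_diff_le:
  fixes a b r s e :: real
  assumes "0 \<le> a" "a \<le> 1" "0 \<le> s" "s \<le> 1" "a - r \<le> e" "b - s \<le> e" "0 \<le> e"
  shows "a * b - r * s \<le> 2 * e"
proof -
  have "a * (b - s) \<le> 1 * e"
    using assms by (meson mult_left_mono mult_right_mono order_trans)
  moreover have "s * (a - r) \<le> 1 * e"
    using assms by (meson mult_left_mono mult_right_mono order_trans)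
  ultimately show ?thesis
    by (simp add: algebra_simps)
qed

lemma lower_limit_iff_rational_bounds:
  fixes x :: "nat \<Rightarrow> real" and a b :: real
  assumes a: "0 \<le> a" "a \<le> 1" and b: "0 \<le> b" "b \<le> 1" and x: "\<And>k. 0 \<le> x k"
  shows "(\<forall>r s. ur r \<le> a \<and> ur s \<le> b \<longrightarrow>
            (\<forall>n>0. \<exists>m. \<forall>k\<ge>m. ur (prod_minus r s n) \<le> x k))
         \<longleftrightarrow> (\<forall>c < a * b. \<forall>\<^sub>F k in sequentially. c < x k)"
    (is "?bounds \<longleftrightarrow> ?lim")
proof
  assume bounds: ?bounds
  show ?lim
  proof (intro allI impI)
    fix c assume "c < a * b"
    \<comment> \<open>one third of the gap for the tolerance \<open>1 / n\<close>, one third for each rational factor\<close>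
    define e where "e = (a * b - c) / 3"
    have e: "0 < e" "c = a * b - 3 * e"
      using \<open>c < a * b\<close> by (simp_all add: e_def field_simps)
    obtain r where r: "ur r \<le> a" "a - e < ur r"
      using ex_ur_approx_below[OF a e(1)] .
    obtain s where s: "ur s \<le> b" "b - e < ur s"
      using ex_ur_approx_below[OF b e(1)] .
    obtain n where n: "0 < n" "1 / real n < e"
      using nat_approx_posE[OF e(1)] by (metis zero_less_Suc)
    obtain m where m: "\<And>k. m \<le> k \<Longrightarrow> ur (prod_minus r s n) \<le> x k"
      using bounds r(1) s(1) n(1) by blast
    have "a * b - ur r * ur s \<le> 2 * e"
      using unit_interval_mult_diff_le[of a "ur s" "ur r" e b] a r s e ur_nonneg ur_le_1 by auto
    then have "c < ur (prod_minus r s n)"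
      using e n by (simp add: ur_prod_minus)
    then show "\<forall>\<^sub>F k in sequentially. c < x k"
      using m unfolding eventually_sequentially by (meson less_le_trans)
  qed
next
  assume lim: ?lim
  show ?bounds
  proof (intro allI impI)
    fix r s and n :: nat
    assume rs: "ur r \<le> a \<and> ur s \<le> b" and "0 < n"
    have "ur r * ur s \<le> a * b"
      using rs a ur_nonneg by (auto intro: mult_mono)
    moreover have "0 < 1 / real n"
      using \<open>0 < n\<close> by simp
    ultimately have "ur r * ur s - 1 / real n < a * b"
      by linarith
    then obtain m where "\<forall>k\<ge>m. ur r * ur s - 1 / real n < x k"
      using lim unfolding eventually_sequentially by blast
    then show "\<exists>m. \<forall>k\<ge>m. ur (prod_minus r s n) \<le> x k"
      using x unfolding ur_prod_minus by (metis less_imp_le max.bounded_iff)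
  qed
qed

lemma upper_limit_iff_rational_bounds:
  fixes x :: "nat \<Rightarrow> real" and a b :: real
  assumes a: "0 \<le> a" "a \<le> 1" and b: "0 \<le> b" "b \<le> 1" and x: "\<And>k. x k \<le> 1"
  shows "(\<forall>r s. a \<le> ur r \<and> b \<le> ur s \<longrightarrow>
            (\<forall>n>0. \<exists>m. \<forall>k\<ge>m. x k \<le> ur (prod_plus r s n)))
         \<longleftrightarrow> (\<forall>c > a * b. \<forall>\<^sub>F k in sequentially. x k < c)"
    (is "?bounds \<longleftrightarrow> ?lim")
proof
  assume bounds: ?bounds
  show ?lim
  proof (intro allI impI)
    fix c assume "a * b < c"
    define e where "e = (c - a * b) / 3"
    have e: "0 < e" "c = a * b + 3 * e"
      using \<open>a * b < c\<close> by (simp_all add: e_def field_simps)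
    obtain r where r: "a \<le> ur r" "ur r < a + e"
      using ex_ur_approx_above[OF a e(1)] .
    obtain s where s: "b \<le> ur s" "ur s < b + e"
      using ex_ur_approx_above[OF b e(1)] .
    obtain n where n: "0 < n" "1 / real n < e"
      using nat_approx_posE[OF e(1)] by (metis zero_less_Suc)
    obtain m where m: "\<And>k. m \<le> k \<Longrightarrow> x k \<le> ur (prod_plus r s n)"
      using bounds r(1) s(1) n(1) by blast
    have "ur r * ur s - a * b \<le> 2 * e"
      using unit_interval_mult_diff_le[of "ur r" b a e "ur s"] b r s e ur_nonneg ur_le_1 by auto
    then have "ur (prod_plus r s n) < c"
      using e n by (simp add: ur_prod_plus min_less_iff_disj)
    then show "\<forall>\<^sub>F k in sequentially. x k < c"
      using m unfolding eventually_sequentially by (meson le_less_trans)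
  qed
next
  assume lim: ?lim
  show ?bounds
  proof (intro allI impI)
    fix r s and n :: nat
    assume rs: "a \<le> ur r \<and> b \<le> ur s" and "0 < n"
    have "a * b \<le> ur r * ur s"
      using rs b ur_nonneg by (auto intro: mult_mono)
    moreover have "0 < 1 / real n"
      using \<open>0 < n\<close> by simp
    ultimately have "a * b < ur r * ur s + 1 / real n"
      by linarith
    then obtain m where "\<forall>k\<ge>m. x k < ur r * ur s + 1 / real n"
      using lim unfolding eventually_sequentially by blast
    then show "\<exists>m. \<forall>k\<ge>m. x k \<le> ur (prod_plus r s n)"
      using x unfolding ur_prod_plus by (metis less_imp_le min.bounded_iff)
  qed
qed

section \<open>Semantics of the formulas\<close>

lemma sat_Next_funpow:
  "sat M f v ((Next ^^ k) \<phi>) w \<longleftrightarrow> sat M f v \<phi> ((f ^^ k) w)"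
  by (induction k arbitrary: w) (simp_all add: funpow_swap1[of f])

text \<open>
  Measurability of the truth set is essential here: \<open>M_op\<close> is defined through the measure of the
  complementary truth set, and the two measures add up to 1 only for events.
\<close>

lemma (in prob_space) sat_M_op_iff:
  assumes "{u \<in> space M. sat M f v \<phi> u} \<in> sets M"
  shows "sat M f v (M_op r \<phi>) w \<longleftrightarrow> measure M {u \<in> space M. sat M f v \<phi> u} \<le> ur r"
proof -
  have "measure M {u \<in> space M. \<not> sat M f v \<phi> u} = 1 - measure M {u \<in> space M. sat M f v \<phi> u}"
    using prob_neg[of "sat M f v \<phi>"] assms by (simp add: pred_def)
  then show ?thesis
    by (simp add: M_op_def ur_compl_unit)
qed

lemma funpow_measurable:
  assumes "f \<in> measurable M M"
  shows "f ^^ k \<in> measurable M M"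
  by (induction k) (auto intro: measurable_compose[OF _ assms])

lemma (in abstract_dynamical_system) sat_Mix_iff:
  fixes v :: "'p \<Rightarrow> 'a set"
  assumes v: "valuation M v"
  shows "sat M f v (Mix p q) w \<longleftrightarrow>
    (\<lambda>k. measure M (((f ^^ k) -` v p \<inter> space M) \<inter> v q)) \<longlonglongrightarrow> measure M (v p) * measure M (v q)"
proof -
  define x where "x k = measure M (((f ^^ k) -` v p \<inter> space M) \<inter> v q)" for k
  let ?\<phi> = "\<lambda>k. And ((Next ^^ k) (Prop p)) (Prop q)"
  have events: "v p \<in> sets M" "v q \<in> sets M"
    using v by (auto simp: valuation_def)
  have truth_set_Prop: "{u \<in> space M. sat M f v (Prop y) u} = v y" for y
    using v sets.sets_into_space[of "v y" M] by (auto simp: valuation_def)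
  have truth_set: "{u \<in> space M. sat M f v (?\<phi> k) u} = ((f ^^ k) -` v p \<inter> space M) \<inter> v q" for k
    by (auto simp: sat_Next_funpow)
  have event: "((f ^^ k) -` v p \<inter> space M) \<inter> v q \<in> sets M" for k
    using measurable_sets[OF funpow_measurable[OF f_measurable] events(1)] events(2) by blast
  have L_Prop: "sat M f v (L r (Prop y)) w \<longleftrightarrow> ur r \<le> measure M (v y)" for r y
    using truth_set_Prop[of y] by simp
  have L_\<phi>: "sat M f v (L r (?\<phi> k)) w \<longleftrightarrow> ur r \<le> x k" for r k
    unfolding sat.simps(4) truth_set x_def ..
  have M_Prop: "sat M f v (M_op r (Prop y)) w \<longleftrightarrow> measure M (v y) \<le> ur r" for r y
    using sat_M_op_iff[of f v "Prop y"] v unfolding truth_set_Prop valuation_def by blast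
  have M_\<phi>: "sat M f v (M_op r (?\<phi> k)) w \<longleftrightarrow> x k \<le> ur r" for r k
    using sat_M_op_iff[of f v "?\<phi> k"] event unfolding truth_set x_def by blast
  have "sat M f v (G_fm p q) w \<longleftrightarrow>
      (\<forall>c < measure M (v p) * measure M (v q). \<forall>\<^sub>F k in sequentially. c < x k)"
    unfolding G_fm_def
    by (subst lower_limit_iff_rational_bounds[symmetric])
       (auto simp: x_def L_Prop L_\<phi>[unfolded x_def] simp del: sat.simps)
  moreover have "sat M f v (L_fm p q) w \<longleftrightarrow>
      (\<forall>c > measure M (v p) * measure M (v q). \<forall>\<^sub>F k in sequentially. x k < c)"
    unfolding L_fm_def
    by (subst upper_limit_iff_rational_bounds[symmetric])
       (auto simp: x_def M_Prop M_\<phi>[unfolded x_def] simp del: sat.simps)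
  ultimately show ?thesis
    unfolding Mix_def sat_And x_def[symmetric] order_tendsto_iff by blast
qed

theorem proposition4p5:
  fixes M :: "'a measure" and f :: "'a \<Rightarrow> 'a" and p q :: "'p::countable"
  assumes "abstract_dynamical_system M f"
    and "p \<noteq> q"
  shows "valid_in M f (Mix p q) \<longleftrightarrow> mixing M f"
proof -
  interpret abstract_dynamical_system M f by fact
  have valid_iff: "valid_in M f (Mix p q) \<longleftrightarrow>
      (\<forall>v. valuation M v \<longrightarrow>
        (\<lambda>k. measure M (((f ^^ k) -` v p \<inter> space M) \<inter> v q))
          \<longlonglongrightarrow> measure M (v p) * measure M (v q))"
    using not_empty by (auto simp: valid_in_def sat_Mix_iff)
  show ?thesis
  proof
    assume valid: "valid_in M f (Mix p q)"
    show "mixing M f"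
      unfolding mixing_def
    proof (intro ballI)
      fix A B assume "A \<in> sets M" "B \<in> sets M"
      then have "valuation M (\<lambda>y. if y = p then A else B)"
        by (simp add: valuation_def)
      then show "(\<lambda>k. measure M (((f ^^ k) -` A \<inter> space M) \<inter> B)) \<longlonglongrightarrow> measure M A * measure M B"
        using valid \<open>p \<noteq> q\<close> unfolding valid_iff by fastforce
    qed
  next
    assume "mixing M f"
    then show "valid_in M f (Mix p q)"
      unfolding valid_iff mixing_def valuation_def by blast
  qed
qed

end
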